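(* There exists a positive constant $x_0$ such that if $x\ge x_0$, then the set $\{1,2,\dots,x\}$ contains $k=\left[0.24(\log x)^{1/4}\right]$ consecutive primes such that the difference between any two distinct primes among these $k$ primes is never a perfect square.
   Context: $\log$ is the natural logarithm and $[y]$ denotes the integer part of $y$. $\{1,2,\dots,x\}$ denotes the set of positive integers not exceeding $x$. "Consecutive primes" means primes $p_{n+1},\dots,p_{n+k}$ that are consecutive in the sequence $p_1<p_2<\cdots$ of all primes. A perfect square is an integer of the form $u^2$ with $u$ an integer. *)

theory Defs
  imports
    Complex_Main
    "HOL-Computational_Algebra.Primes"
    "HOL-Computational_Algebra.Nth_Powers"
    "HOL-Library.Infinite_Set"
begin

(* enumerate counts from 0, so enumerate {p. prime p} m is the (m+1)-st prime and the
   index range {n..<n + k} yields the (n+1)-st up to the (n+k)-th prime. *)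
definition consecutive_primes :: "nat \<Rightarrow> nat set \<Rightarrow> bool" where
  "consecutive_primes k S \<longleftrightarrow> (\<exists>n. S = enumerate {p::nat. prime p} ` {n..<n + k})"

end

theory Submission
  imports
    Defs
    "HOL-Number_Theory.Cong"
    "HOL-Analysis.Harmonic_Numbers"
    "HOL-Real_Asymp.Real_Asymp"
begin

text \<open>
  The proof is a counting argument. Write \<open>n\<close> for the integer part of \<open>x\<close> and \<open>L = ln n\<close>, so that
  \<open>k \<le> L powr (1/4)\<close>. Chebyshev's lower bound \<open>\<pi>(n) \<ge> n / (2 * L)\<close>
  (\<open>prime_count_lower_bound\<close>) yields at least about \<open>n / (2 * k * L)\<close> disjoint blocks of \<open>k\<close> consecutive
  primes up to \<open>n\<close>. The blocks are disjoint subintervals of \<open>[0, n]\<close>, so only a fraction of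
  them is longer than \<open>8 * k * L\<close>. If each of the remaining blocks contained a square difference
  \<open>u\<^sup>2\<close>, then each would give its own pair of primes \<open>m\<close>, \<open>m + u\<^sup>2\<close> with \<open>u\<close> of order at most
  \<open>sqrt (k * L) \<le> L powr (5/8)\<close> (\<open>card_blocks_with_difference_le\<close>).

  A sieve shows that there are too few such pairs. For a fixed difference \<open>h\<close> of size at most \<open>L\<^sup>2\<close>
  there are at most \<open>n / L powr 1.9\<close> of them (\<open>card_prime_pairs_asymptotic\<close>), and hence at most a
  constant times \<open>n / L powr 1.275\<close> altogether, against at least a constant times
  \<open>n / L powr 1.25\<close> blocks.

  Any exponent above \<open>15/8\<close> in place of \<open>1.9\<close> would do. Brun's pure sieve
  (\<open>sieve_fundamental_lemma\<close>) is therefore strong enough, because it saves \<open>L\<^sup>2\<close> up to powers of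
  \<open>ln L\<close>. Its input about the primes is that \<open>\<Prod> 1 / (1 - 1 / p)\<close>, taken over the primes up to \<open>z\<close>,
  is at least \<open>ln (z + 1)\<close> and grows by a factor of at most two when \<open>z\<close> increases by one.
\<close>

section \<open>Chebyshev's lower bound for the number of primes\<close>

text \<open>
  The numbers \<open>1 / ((m + 1) * (m choose k))\<close> form Leibniz's harmonic triangle, in which every
  entry is the sum of the two entries below it. Starting from the left edge
  \<open>1 / (m + 1)\<close>, this recurrence produces every entry by subtraction alone.
\<close>
lemma inverse_leibniz_triangle:
  assumes "k \<le> m"
  shows "1 / (real (m + 2) * real (Suc m choose Suc k)) =
         1 / (real (m + 1) * real (m choose k)) - 1 / (real (m + 2) * real (Suc m choose k))"
proof -
  define a where "a = real (m choose k)"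
  have a: "a > 0" using assms by (simp add: a_def)
  have "Suc k * (Suc m choose Suc k) = Suc m * (m choose k)"
    by (rule Suc_times_binomial)
  hence "real (Suc k) * real (Suc m choose Suc k) = real (Suc m) * a"
    unfolding a_def by (metis of_nat_mult)
  hence 1: "real (Suc m choose Suc k) = real (Suc m) * a / real (Suc k)"
    by (simp add: field_simps)
  have "(Suc m - k) * (Suc m choose k) = Suc m * (m choose k)"
    using binomial_absorb_comp[of "Suc m" k] by simp
  hence "real (Suc m - k) * real (Suc m choose k) = real (Suc m) * a"
    unfolding a_def by (metis of_nat_mult)
  moreover have "real (Suc m - k) = real m + 1 - real k" using assms by simp
  ultimately have 2: "real (Suc m choose k) = real (Suc m) * a / (real m + 1 - real k)"
    using assms by (simp add: field_simps)
  have "real m + 1 - real k > 0" using assms by simp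
  thus ?thesis using a
    unfolding 1 2 a_def[symmetric] by (simp add: divide_simps)
qed

lemma Lcm_atLeastAtMost_pos: "Lcm {1..n} > (0::nat)"
  using Lcm_0_iff_nat[of "{1..n}"] by (intro gr0I) auto

text \<open>
  Every entry in the first \<open>N\<close> rows of the triangle is an integer combination of
  \<open>1, 1/2, \<dots>, 1/N\<close>, so multiplying it by \<open>Lcm {1..N}\<close> gives an integer, and this integer is positive.
\<close>
lemma leibniz_denominator_le_Lcm:
  assumes "k \<le> m" "m < N"
  shows "(m + 1) * (m choose k) \<le> Lcm {1..N}"
proof -
  define D where "D = Lcm {1..N}"
  have D: "D > 0" unfolding D_def by (rule Lcm_atLeastAtMost_pos)
  have "real D / (real (m + 1) * real (m choose k)) \<in> \<int>"
    using assms
  proof (induction k arbitrary: m)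
    case 0
    hence "m + 1 dvd D" unfolding D_def by (intro dvd_Lcm) auto
    then obtain c where "D = (m + 1) * c" by (auto elim: dvdE)
    hence "real D / real (m + 1) = real c" by (metis nonzero_mult_div_cancel_left of_nat_mult of_nat_eq_0_iff add_is_0 one_neq_zero)
    thus ?case by simp
  next
    case (Suc k)
    then obtain m' where m: "m = Suc m'" by (cases m) auto
    have "real D / (real (m + 1) * real (m choose Suc k)) =
        real D * (1 / (real (m' + 2) * real (Suc m' choose Suc k)))"
      using m by simp
    also have "\<dots> = real D * (1 / (real (m' + 1) * real (m' choose k)) - 1 / (real (m' + 2) * real (Suc m' choose k)))"
      using Suc.prems m by (subst inverse_leibniz_triangle) simp_all
    also have "\<dots> = real D / (real (m' + 1) * real (m' choose k)) - real D / (real (m + 1) * real (m choose k))"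
      using m by (simp add: right_diff_distrib)
    finally have "real D / (real (m + 1) * real (m choose Suc k)) =
        real D / (real (m' + 1) * real (m' choose k)) - real D / (real (m + 1) * real (m choose k))" .
    thus ?case using Suc.IH[of m'] Suc.IH[of m] Suc.prems m by (simp add: Ints_diff)
  qed
  then obtain z :: int where z: "real D / (real (m + 1) * real (m choose k)) = of_int z"
    by (elim Ints_cases)
  have pos: "real (m + 1) * real (m choose k) > 0" using assms by simp
  hence "of_int z > (0::real)" using D unfolding z[symmetric] by simp
  hence "of_int z \<ge> (1::real)" by simp
  hence "real (m + 1) * real (m choose k) \<le> real D" using pos unfolding z[symmetric] by (simp add: le_divide_eq)
  thus ?thesis unfolding D_def by (metis of_nat_le_iff of_nat_mult)
qed

text \<open>Sum the previous bound over row \<open>n\<close>, whose binomial coefficients add up to \<open>2 ^ n\<close>.\<close>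
lemma power_two_le_Lcm: "2 ^ n \<le> Lcm {1..Suc n}"
proof -
  have "(n + 1) * 2 ^ n = (\<Sum>k\<le>n. (n + 1) * (n choose k))"
    by (simp only: choose_row_sum flip: sum_distrib_left)
  also have "\<dots> \<le> (\<Sum>k\<le>n. Lcm {1..Suc n})"
    by (intro sum_mono leibniz_denominator_le_Lcm) auto
  also have "\<dots> = (n + 1) * Lcm {1..Suc n}" by simp
  finally show ?thesis by (subst (asm) mult_le_cancel1) simp
qed

lemma prime_power_dvd_LcmE:
  fixes p :: nat
  assumes "prime p" "p ^ a dvd Lcm {1..n}" "n > 0"
  obtains m where "m \<in> {1..n}" "p ^ a dvd m"
proof -
  have "\<exists>m\<in>{1..n}. p ^ a dvd m" using assms(2,3)
  proof (induction n)
    case (Suc n)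
    show ?case
    proof (cases "n = 0")
      case True
      thus ?thesis using Suc by auto
    next
      case False
      have "{1..Suc n} = insert (Suc n) {1..n}" by auto
      hence "p ^ a dvd lcm (Suc n) (Lcm {1..n})" using Suc.prems by simp
      hence "p ^ a dvd Suc n \<or> p ^ a dvd Lcm {1..n}"
        using Lcm_atLeastAtMost_pos[of n] assms(1)
        by (simp add: power_dvd_iff_le_multiplicity multiplicity_lcm le_max_iff_disj lcm_eq_0_iff del: One_nat_def)
      thus ?thesis using Suc.IH False by (force intro: bexI[of _ "Suc n"])
    qed
  qed simp
  thus ?thesis using that by blast
qed

text \<open>
  A prime power dividing \<open>Lcm {1..n}\<close> already divides one of the numbers \<open>1, \<dots>, n\<close>. Hence each
  of the at most \<open>\<pi>(n)\<close> prime powers in its factorization is at most \<open>n\<close>.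
\<close>
lemma Lcm_le_power_prime_count:
  fixes n :: nat
  assumes "n > 0"
  shows "Lcm {1..n} \<le> n ^ card {p. prime p \<and> p \<le> n}"
proof -
  define D where "D = Lcm {1..n}"
  have D: "D > 0" unfolding D_def by (rule Lcm_atLeastAtMost_pos)
  have le: "p ^ multiplicity p D \<le> n" if p: "prime p" for p
  proof -
    have "p ^ multiplicity p D dvd Lcm {1..n}" unfolding D_def by (rule multiplicity_dvd)
    then obtain m where m: "m \<in> {1..n}" "p ^ multiplicity p D dvd m"
      by (rule prime_power_dvd_LcmE[OF p _ assms])
    hence "p ^ multiplicity p D \<le> m" by (intro dvd_imp_le) auto
    thus ?thesis using m by simp
  qed
  have sub: "prime_factors D \<subseteq> {p. prime p \<and> p \<le> n}"
  proof
    fix p assume p: "p \<in> prime_factors D"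
    have prime: "prime p" using p by (rule in_prime_factors_imp_prime)
    have "p ^ 1 dvd Lcm {1..n}"
      using in_prime_factors_imp_dvd[OF p] by (simp only: D_def power_one_right)
    then obtain m where m: "m \<in> {1..n}" "p ^ 1 dvd m"
      by (rule prime_power_dvd_LcmE[OF prime _ assms])
    hence "p ^ 1 \<le> m" by (intro dvd_imp_le) auto
    thus "p \<in> {p. prime p \<and> p \<le> n}" using prime m by simp
  qed
  have "D = (\<Prod>p\<in>prime_factors D. p ^ multiplicity p D)"
    using prod_prime_factors[of D] D by simp
  also have "\<dots> \<le> (\<Prod>p\<in>prime_factors D. n)"
    by (intro prod_mono) (auto intro: le)
  also have "\<dots> = n ^ card (prime_factors D)" by simp
  also have "\<dots> \<le> n ^ card {p. prime p \<and> p \<le> n}"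
    using sub assms by (intro power_increasing card_mono) auto
  finally show ?thesis by (simp add: D_def)
qed

text \<open>
  Chebyshev's lower bound. The lower and upper bounds for \<open>Lcm {1..n}\<close> above give
  \<open>2 ^ (n - 1) \<le> n ^ \<pi>(n)\<close>, and \<open>ln 2 \<ge> 2/3\<close> absorbs the loss from \<open>n\<close> to \<open>n - 1\<close>.
\<close>
lemma prime_count_lower_bound:
  assumes "n \<ge> 4"
  shows "real n / (2 * ln (real n)) \<le> real (card {p. prime p \<and> p \<le> n})"
proof -
  have "2 ^ (n - 1) \<le> n ^ card {p. prime p \<and> p \<le> n}"
    using power_two_le_Lcm[of "n - 1"] Lcm_le_power_prime_count[of n] assms by simp
  hence "(2::real) ^ (n - 1) \<le> real n ^ card {p. prime p \<and> p \<le> n}"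
    by (metis of_nat_le_iff of_nat_numeral of_nat_power)
  hence "ln ((2::real) ^ (n - 1)) \<le> ln (real n ^ card {p. prime p \<and> p \<le> n})"
    using assms by (subst ln_le_cancel_iff) auto
  hence *: "(real n - 1) * ln 2 \<le> real (card {p. prime p \<and> p \<le> n}) * ln (real n)"
    using assms by (simp add: ln_realpow of_nat_diff)
  have "real n / 2 \<le> (real n - 1) * (2 / 3)" using assms by simp
  also have "\<dots> \<le> (real n - 1) * ln 2"
    using assms ln2_ge_two_thirds by (intro mult_left_mono) auto
  finally have "real n / 2 \<le> real (card {p. prime p \<and> p \<le> n}) * ln (real n)"
    using * by linarith
  thus ?thesis using assms by (simp add: field_simps)
qed

section \<open>Brun's pure sieve\<close>

lemma card_residue_class_window:
  fixes a d Y :: nat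
  assumes "d > 0"
  shows "card {n \<in> {Y<..Y + d}. [n = a] (mod d)} = 1"
proof -
  have inj: "inj_on (\<lambda>n. n mod d) {Y<..Y + d}"
  proof (rule linorder_inj_onI)
    fix m n assume mn: "m < n" "m \<in> {Y<..Y + d}" "n \<in> {Y<..Y + d}"
    show "m mod d \<noteq> n mod d"
    proof
      assume "m mod d = n mod d"
      hence "d dvd n - m" using mn by (metis less_imp_le mod_eq_dvd_iff_nat)
      hence "d \<le> n - m" using mn by (intro dvd_imp_le) auto
      thus False using mn by auto
    qed
  qed auto
  have "(\<lambda>n. n mod d) ` {Y<..Y + d} = {..<d}"
    using inj assms by (intro card_subset_eq) (auto simp: card_image)
  moreover have "a mod d \<in> {..<d}" using assms by simp
  ultimately obtain n where n: "n \<in> {Y<..Y + d}" "n mod d = a mod d" by (metis imageE)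
  have "{n \<in> {Y<..Y + d}. [n = a] (mod d)} = {n}"
  proof (intro equalityI subsetI)
    fix m assume "m \<in> {n \<in> {Y<..Y + d}. [n = a] (mod d)}"
    hence "m mod d = n mod d" "m \<in> {Y<..Y + d}" using n by (auto simp: unique_euclidean_semiring_class.cong_def)
    thus "m \<in> {n}" using inj_onD[OF inj] n(1) by simp
  qed (use n in \<open>simp add: unique_euclidean_semiring_class.cong_def\<close>)
  thus ?thesis by simp
qed

lemma card_residue_class_approx:
  fixes a d X :: nat
  assumes "d > 0"
  shows "\<bar>real (card {n \<in> {1..X}. [n = a] (mod d)}) - real X / real d\<bar> \<le> 1"
proof (induction X rule: less_induct)
  case (less X)
  show ?case
  proof (cases "X < d")
    case True
    have "{n \<in> {1..X}. [n = a] (mod d)} \<subseteq> {n \<in> {0<..0 + d}. [n = a] (mod d)}"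
      using True by auto
    hence "card {n \<in> {1..X}. [n = a] (mod d)} \<le> card {n \<in> {0<..0 + d}. [n = a] (mod d)}"
      by (intro card_mono) auto
    hence "card {n \<in> {1..X}. [n = a] (mod d)} \<le> 1"
      using card_residue_class_window[OF assms, of 0 a] by simp
    hence "real (card {n \<in> {1..X}. [n = a] (mod d)}) \<le> 1" by linarith
    moreover have "real X / real d \<le> 1" using True by simp
    moreover have "real X / real d \<ge> 0" by simp
    ultimately show ?thesis by linarith
  next
    case False
    have "{n \<in> {1..X}. [n = a] (mod d)} =
          {n \<in> {1..X - d}. [n = a] (mod d)} \<union> {n \<in> {X - d<..(X - d) + d}. [n = a] (mod d)}"
      using False by auto
    hence "card {n \<in> {1..X}. [n = a] (mod d)} =
          card {n \<in> {1..X - d}. [n = a] (mod d)} + card {n \<in> {X - d<..(X - d) + d}. [n = a] (mod d)}"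
      by (simp only:) (rule card_Un_disjoint, auto)
    hence "card {n \<in> {1..X}. [n = a] (mod d)} = card {n \<in> {1..X - d}. [n = a] (mod d)} + 1"
      using card_residue_class_window[OF assms, of "X - d" a] by simp
    moreover have "real X / real d = real (X - d) / real d + 1"
      using False assms by (simp add: of_nat_diff field_simps)
    ultimately show ?thesis using less.IH[of "X - d"] False assms by simp
  qed
qed

lemma power_add_ge_two_terms:
  fixes x y :: real
  assumes "x \<ge> 0" "y \<ge> 0"
  shows "x ^ Suc s + real (Suc s) * y * x ^ s \<le> (x + y) ^ Suc s"
proof (induction s)
  case (Suc s)
  have "x ^ Suc (Suc s) + real (Suc (Suc s)) * y * x ^ Suc s \<le>
        (x ^ Suc s + real (Suc s) * y * x ^ s) * (x + y)"
    using assms by (simp add: algebra_simps)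
  also have "\<dots> \<le> (x + y) ^ Suc s * (x + y)"
    using Suc assms by (intro mult_right_mono) auto
  finally show ?case by (simp add: mult.commute)
qed simp

text \<open>
  The sifted set carries a residue condition modulo \<open>d\<close> so that the sieve estimate can be proved by
  induction on the set of sieving moduli: removing one forbidden class modulo \<open>q\<close> leads to a
  sifted set whose residue condition is modulo \<open>d * q\<close>.
\<close>
definition sifted :: "(nat \<Rightarrow> nat set) \<Rightarrow> nat set \<Rightarrow> nat \<Rightarrow> nat \<Rightarrow> nat \<Rightarrow> nat set" where
  "sifted \<Omega> Q a d X = {n \<in> {1..X}. [n = a] (mod d) \<and> (\<forall>q\<in>Q. n mod q \<notin> \<Omega> q)}"

lemma finite_sifted [simp]: "finite (sifted \<Omega> Q a d X)"
  by (simp add: sifted_def)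

text \<open>
  Buchstab's identity: what the modulus \<open>q\<close> removes is, by the Chinese remainder theorem, a disjoint
  union of sifted sets for the remaining moduli in residue classes modulo \<open>d * q\<close>.
\<close>
lemma card_sifted_insert:
  assumes "coprime d q" "d > 0" "q > 0" "\<Omega> q \<subseteq> {..<q}"
  obtains b where
    "card (sifted \<Omega> Q a d X) =
       card (sifted \<Omega> (insert q Q) a d X) + (\<Sum>c\<in>\<Omega> q. card (sifted \<Omega> Q (b c) (d * q) X))"
proof -
  have "\<forall>c. \<exists>b. [b = a] (mod d) \<and> [b = c] (mod q)"
    using binary_chinese_remainder_nat[OF assms(1)] by blast
  then obtain b where b: "\<And>c. [b c = a] (mod d)" "\<And>c. [b c = c] (mod q)" by metis
  have cong: "[n = b c] (mod d * q) \<longleftrightarrow> [n = a] (mod d) \<and> [n = c] (mod q)" for n c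
    using b[of c] assms(1) 
    by (meson cong_trans cong_sym coprime_cong_mult_nat cong_modulus_mult_nat 
         cong_dvd_modulus_nat dvd_triv_right)
  have fin: "finite (\<Omega> q)" using assms(4) finite_subset by blast
  have eq: "sifted \<Omega> Q (b c) (d * q) X =
      {n \<in> sifted \<Omega> Q a d X. n mod q = c}" if "c \<in> \<Omega> q" for c
  proof -
    have "[n = c] (mod q) \<longleftrightarrow> n mod q = c" for n
    proof -
      have "c < q" using that assms(4) by auto
      thus ?thesis by (simp add: unique_euclidean_semiring_class.cong_def)
    qed
    thus ?thesis unfolding sifted_def cong by auto
  qed
  have "sifted \<Omega> Q a d X =
      sifted \<Omega> (insert q Q) a d X \<union> (\<Union>c\<in>\<Omega> q. sifted \<Omega> Q (b c) (d * q) X)"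
    by (auto simp: eq) (auto simp: sifted_def)
  also have "card \<dots> = card (sifted \<Omega> (insert q Q) a d X) +
      card (\<Union>c\<in>\<Omega> q. sifted \<Omega> Q (b c) (d * q) X)"
    using fin by (intro card_Un_disjoint) (auto simp: eq, auto simp: sifted_def)
  also have "card (\<Union>c\<in>\<Omega> q. sifted \<Omega> Q (b c) (d * q) X) =
      (\<Sum>c\<in>\<Omega> q. card (sifted \<Omega> Q (b c) (d * q) X))"
    using fin by (intro card_UN_disjoint) (auto simp: eq)
  finally show ?thesis using that by blast
qed

text \<open>
  Brun's pure sieve. The expected main term is \<open>X / d\<close> times the density of the classes that
  survive. The parameter \<open>t\<close> is the depth to which Buchstab's identity is iterated: at depth
  \<open>0\<close> only the trivial bound remains, and passing from \<open>t\<close> to \<open>t + 1\<close> for one new modulus \<open>q\<close> adds at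
  most \<open>\<kappa>\<close> error terms of depth \<open>t\<close>. Iterating gives the \<open>t\<close>-th elementary symmetric
  function of the \<open>\<kappa> / q\<close>, bounded here by \<open>\<sigma> ^ t / t!\<close>, and a count of the rounding errors, bounded by
  \<open>(1 + \<kappa> * card Q) ^ t\<close>.
\<close>
theorem sieve_fundamental_lemma:
  fixes \<kappa> X :: nat
  assumes "finite Q" "d > 0" "\<And>q. q \<in> Q \<Longrightarrow> coprime d q"
    and "pairwise coprime Q" "\<And>q. q \<in> Q \<Longrightarrow> q > 0"
    and "\<And>q. q \<in> Q \<Longrightarrow> \<Omega> q \<subseteq> {..<q}" "\<And>q. q \<in> Q \<Longrightarrow> card (\<Omega> q) \<le> \<kappa>"
  shows "\<bar>real (card (sifted \<Omega> Q a d X)) - real X / real d * (\<Prod>q\<in>Q. 1 - real (card (\<Omega> q)) / real q)\<bar>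
     \<le> real X / real d * (\<Sum>q\<in>Q. real \<kappa> / real q) ^ t / fact t + (1 + real \<kappa> * real (card Q)) ^ t"
  using assms
proof (induction Q arbitrary: a d t rule: finite_induct)
  case empty
  show ?case
  proof (cases t)
    case 0
    have "real X / real d \<ge> 0" by simp
    hence "\<bar>real (card {n \<in> {1..X}. [n = a] (mod d)}) - real X / real d\<bar> \<le> real X / real d + 1"
      using card_residue_class_approx[OF \<open>d > 0\<close>, of X a] by linarith
    thus ?thesis using 0 by (simp add: sifted_def)
  next
    case (Suc s)
    thus ?thesis using card_residue_class_approx[OF \<open>d > 0\<close>, of X a] by (simp add: sifted_def)
  qed
next
  case (insert q Q a d t)
  note prems = insert.prems
  define V where "V = (\<Prod>q\<in>Q. 1 - real (card (\<Omega> q)) / real q)"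
  define \<sigma> where "\<sigma> = (\<Sum>q\<in>Q. real \<kappa> / real q)"
  define R where "R = 1 + real \<kappa> * real (card Q)"
  define w where "w = real (card (\<Omega> q))"
  have q: "q > 0" "coprime d q" "\<Omega> q \<subseteq> {..<q}" "w \<le> \<kappa>" using prems by (auto simp: w_def)
  have w0: "w \<ge> 0" by (simp add: w_def)
  have cop: "coprime q r" if "r \<in> Q" for r
    using prems(3) that insert.hyps by (auto simp: pairwise_insert)
  have factor: "1 - real (card (\<Omega> r)) / real r \<in> {0..1}" if "r \<in> insert q Q" for r
  proof -
    have "card (\<Omega> r) \<le> card {..<r}" using prems(5)[OF that] by (intro card_mono) auto
    thus ?thesis using prems(4)[OF that] by simp
  qed
  show ?case
  proof (cases t)
    case 0
    have "card (sifted \<Omega> (insert q Q) a d X) \<le> card {n \<in> {1..X}. [n = a] (mod d)}"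
      by (intro card_mono) (auto simp: sifted_def)
    hence "real (card (sifted \<Omega> (insert q Q) a d X)) \<le> real X / real d + 1"
      using card_residue_class_approx[OF \<open>d > 0\<close>, of X a] by linarith
    moreover define V' where "V' = (\<Prod>q\<in>insert q Q. 1 - real (card (\<Omega> q)) / real q)"
    have "0 \<le> V'" "V' \<le> 1" unfolding V'_def using factor
      by (auto intro!: prod_nonneg prod_le_1 simp del: prod.insert)
    hence "0 \<le> real X / real d * V'" "real X / real d * V' \<le> real X / real d"
      by (simp, intro mult_left_le) simp_all
    ultimately show ?thesis unfolding 0 V'_def[symmetric]
      by (simp add: abs_le_iff)
  next
    case (Suc s)
    obtain b where b: "card (sifted \<Omega> Q a d X) =
       card (sifted \<Omega> (insert q Q) a d X) + (\<Sum>c\<in>\<Omega> q. card (sifted \<Omega> Q (b c) (d * q) X))"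
      using card_sifted_insert[of d q \<Omega> Q a X] q \<open>d > 0\<close> by blast
    define T where "T = real X / real d"
    have T0: "T \<ge> 0" by (simp add: T_def)
    have \<sigma>0: "\<sigma> \<ge> 0" unfolding \<sigma>_def by (intro sum_nonneg) auto
    have R1: "R \<ge> 1" by (simp add: R_def)
    have IH1: "\<bar>real (card (sifted \<Omega> Q a d X)) - T * V\<bar> \<le> T * \<sigma> ^ Suc s / fact (Suc s) + R ^ Suc s"
      unfolding T_def V_def \<sigma>_def R_def using prems
      by (intro insert.IH) (auto simp: pairwise_insert)
    have IH2: "\<bar>real (card (sifted \<Omega> Q (b c) (d * q) X)) - T / q * V\<bar>
        \<le> T / q * \<sigma> ^ s / fact s + R ^ s" for c
    proof -
      have "T / q = real X / real (d * q)" by (simp add: T_def)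
      thus ?thesis
        unfolding V_def \<sigma>_def R_def using prems q cop
        by (simp only:) (intro insert.IH, auto simp: pairwise_insert)
    qed
    have "\<bar>(\<Sum>c\<in>\<Omega> q. real (card (sifted \<Omega> Q (b c) (d * q) X))) - w * (T / q * V)\<bar> =
        \<bar>\<Sum>c\<in>\<Omega> q. real (card (sifted \<Omega> Q (b c) (d * q) X)) - T / q * V\<bar>"
      by (simp add: sum_subtractf w_def)
    also have "\<dots> \<le> (\<Sum>c\<in>\<Omega> q. T / q * \<sigma> ^ s / fact s + R ^ s)"
      using IH2 by (intro order.trans[OF sum_abs] sum_mono) auto
    also have "\<dots> = w * (T / q * \<sigma> ^ s / fact s + R ^ s)" by (simp add: w_def)
    also have "\<dots> \<le> \<kappa> * (T / q * \<sigma> ^ s / fact s + R ^ s)"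
      using q T0 \<sigma>0 R1 by (intro mult_right_mono add_nonneg_nonneg) auto
    finally have 2: "\<bar>(\<Sum>c\<in>\<Omega> q. real (card (sifted \<Omega> Q (b c) (d * q) X))) - w * (T / q * V)\<bar>
        \<le> \<kappa> * (T / q * \<sigma> ^ s / fact s + R ^ s)" .
    have 3: "real (card (sifted \<Omega> Q a d X)) = real (card (sifted \<Omega> (insert q Q) a d X)) +
        (\<Sum>c\<in>\<Omega> q. real (card (sifted \<Omega> Q (b c) (d * q) X)))"
      unfolding b by simp
    have 4: "T * ((1 - w / q) * V) = T * V - w * (T / q * V)"
      by (simp add: algebra_simps)
    have 5: "T * \<sigma> ^ Suc s / fact (Suc s) + \<kappa> * (T / q * \<sigma> ^ s / fact s)
        \<le> T * (\<kappa> / q + \<sigma>) ^ Suc s / fact (Suc s)"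
    proof -
      have "T * \<sigma> ^ Suc s / fact (Suc s) + \<kappa> * (T / q * \<sigma> ^ s / fact s) =
         T / fact (Suc s) * (\<sigma> ^ Suc s + real (Suc s) * (\<kappa> / q) * \<sigma> ^ s)"
        using q(1) by (simp add: divide_simps) (simp add: algebra_simps)
      also have "\<dots> \<le> T / fact (Suc s) * (\<sigma> + \<kappa> / q) ^ Suc s"
        using T0 \<sigma>0 by (intro mult_left_mono power_add_ge_two_terms) auto
      finally show ?thesis by (simp add: add.commute)
    qed
    have 6: "R ^ Suc s + \<kappa> * R ^ s \<le> (R + \<kappa>) ^ Suc s"
    proof -
      have "R ^ Suc s + \<kappa> * R ^ s = (R + \<kappa>) * R ^ s" by (simp add: algebra_simps)
      also have "\<dots> \<le> (R + \<kappa>) * (R + \<kappa>) ^ s"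
        using R1 by (intro mult_left_mono power_mono) auto
      finally show ?thesis by simp
    qed
    have 7: "1 + real \<kappa> * real (card (insert q Q)) = R + \<kappa>"
      using insert.hyps by (simp add: R_def algebra_simps)
    have 8: "(\<Prod>r\<in>insert q Q. 1 - real (card (\<Omega> r)) / real r) = (1 - w / q) * V"
      "(\<Sum>r\<in>insert q Q. real \<kappa> / real r) = \<kappa> / q + \<sigma>"
      using insert.hyps by (simp_all add: V_def \<sigma>_def w_def)
    \<comment> \<open>The triangle inequality for Buchstab's identity, with the two kinds of error kept apart.\<close>
    have combine: "\<bar>A - (C - D)\<bar> \<le> G + G'"
      if "\<bar>A + B - C\<bar> \<le> E + F" "\<bar>B - D\<bar> \<le> E' + F'" "E + E' \<le> G" "F + F' \<le> G'"
      for A B C D E E' F F' G G' :: real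
      using that by linarith
    show ?thesis
      unfolding Suc 7 8 T_def[symmetric] 4
      by (rule combine[OF IH1[unfolded 3] 2[unfolded distrib_left] 5 6])
  qed
qed

section \<open>Partial Euler products\<close>

text \<open>
  A finite form of Euler's product. If \<open>f P\<close> is the sum on the left, then splitting off the multiples
  of a new prime \<open>p\<close> gives \<open>f (insert p P) \<le> f P + f (insert p P) / p\<close>, which is the
  passage from one partial product to the next.
\<close>
lemma sum_inverse_smooth_le:
  fixes P :: "nat set"
  assumes "finite P" "\<And>p. p \<in> P \<Longrightarrow> prime p"
  shows "(\<Sum>n | n \<in> {1..N} \<and> prime_factors n \<subseteq> P. 1 / real n) \<le> (\<Prod>p\<in>P. 1 / (1 - 1 / real p))"
  using assms
proof (induction P rule: finite_induct)
  case empty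
  have "{n. n \<in> {1..N} \<and> prime_factors n \<subseteq> {}} \<subseteq> {1}"
    by (auto simp: prime_factorization_empty_iff)
  hence "(\<Sum>n | n \<in> {1..N} \<and> prime_factors n \<subseteq> {}. 1 / real n) \<le> (\<Sum>n\<in>{1}. 1 / real n)"
    by (intro sum_mono2) auto
  thus ?case by simp
next
  case (insert p P)
  define S where "S = (\<lambda>P. {n. n \<in> {1..N} \<and> prime_factors n \<subseteq> P})"
  define f where "f = (\<lambda>P. \<Sum>n\<in>S P. 1 / real n)"
  have p: "prime p" "p > 1" using insert.prems prime_gt_1_nat by auto
  have fin: "finite (S P)" for P by (simp add: S_def)
  have "S (insert p P) \<subseteq> S P \<union> (\<lambda>m. p * m) ` S (insert p P)"
  proof
    fix n assume n: "n \<in> S (insert p P)"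
    show "n \<in> S P \<union> (\<lambda>m. p * m) ` S (insert p P)"
    proof (cases "p dvd n")
      case True
      then obtain m where m: "n = p * m" by auto
      have "m \<ge> 1" using n m by (cases m) (auto simp: S_def)
      moreover have "m \<le> n" using m p by simp
      moreover have "prime_factors m \<subseteq> prime_factors n"
        using m n by (intro dvd_prime_factors) (auto simp: S_def)
      ultimately have "m \<in> S (insert p P)" using n by (auto simp: S_def)
      thus ?thesis using m by blast
    next
      case False
      hence "p \<notin> prime_factors n" by auto
      thus ?thesis using n by (auto simp: S_def)
    qed
  qed
  hence "f (insert p P) \<le> (\<Sum>n\<in>S P \<union> (\<lambda>m. p * m) ` S (insert p P). 1 / real n)"
    unfolding f_def using fin by (intro sum_mono2) auto
  also have "\<dots> \<le> f P + (\<Sum>n\<in>(\<lambda>m. p * m) ` S (insert p P). 1 / real n)"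
    using sum.union_inter[OF fin[of P] finite_imageI[OF fin[of "insert p P"], of "\<lambda>m. p * m"], of "\<lambda>n. 1 / real n"]
      sum_nonneg[of "S P \<inter> (\<lambda>m. p * m) ` S (insert p P)" "\<lambda>n. 1 / real n"]
    unfolding f_def by simp
  also have "(\<Sum>n\<in>(\<lambda>m. p * m) ` S (insert p P). 1 / real n) = (\<Sum>n\<in>S (insert p P). 1 / real (p * n))"
    using p by (subst sum.reindex) (auto simp: inj_on_def)
  also have "\<dots> = f (insert p P) / real p"
    unfolding f_def sum_divide_distrib by (intro sum.cong) simp_all
  finally have "f (insert p P) * (1 - 1 / real p) \<le> f P" by (simp add: algebra_simps)
  also have "f P \<le> (\<Prod>p\<in>P. 1 / (1 - 1 / real p))"
    using insert unfolding f_def S_def by auto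
  finally have "f (insert p P) \<le> (\<Prod>p\<in>P. 1 / (1 - 1 / real p)) / (1 - 1 / real p)"
    using p by (subst pos_le_divide_eq) auto
  also have "\<dots> = (\<Prod>p\<in>insert p P. 1 / (1 - 1 / real p))"
    using insert.hyps by simp
  finally show ?case by (simp only: f_def S_def)
qed

definition euler_product :: "nat \<Rightarrow> real" where
  "euler_product z = (\<Prod>p | prime p \<and> p \<le> z. 1 / (1 - 1 / real p))"

lemma ln_le_euler_product: "ln (real z + 1) \<le> euler_product z"
proof -
  have "ln (real z + 1) \<le> harm z" by (rule ln_le_harm)
  also have "harm z = (\<Sum>n\<in>{1..z}. 1 / real n)" by (simp add: harm_def inverse_eq_divide)
  also have "{1..z} = {n. n \<in> {1..z} \<and> prime_factors n \<subseteq> {p. prime p \<and> p \<le> z}}"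
    by (auto dest!: dvd_imp_le)
  also have "(\<Sum>n\<in>\<dots>. 1 / real n) \<le> euler_product z"
    unfolding euler_product_def by (intro sum_inverse_smooth_le) auto
  finally show ?thesis .
qed

lemma euler_product_Suc_le: "euler_product (Suc z) \<le> 2 * euler_product z"
proof -
  have nonneg: "euler_product z \<ge> 0"
    unfolding euler_product_def by (intro prod_nonneg) (auto dest: prime_gt_1_nat)
  show ?thesis
  proof (cases "prime (Suc z)")
    case True
    have "{p. prime p \<and> p \<le> Suc z} = insert (Suc z) {p. prime p \<and> p \<le> z}"
      using True by (auto simp: le_Suc_eq)
    hence "euler_product (Suc z) = 1 / (1 - 1 / real (Suc z)) * euler_product z"
      unfolding euler_product_def by simp
    also have "\<dots> \<le> 2 * euler_product z"
      using prime_gt_1_nat[OF True] nonneg by (intro mult_right_mono) (auto simp: field_simps)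
    finally show ?thesis .
  next
    case False
    hence "{p. prime p \<and> p \<le> Suc z} = {p. prime p \<and> p \<le> z}"
      by (auto simp: le_Suc_eq)
    thus ?thesis using nonneg unfolding euler_product_def by simp
  qed
qed

text \<open>
  The product is unbounded and at most doubles in each step, so it can be stopped at a prescribed size
  \<open>M\<close> up to a factor of two. Stopping there controls the sum
  \<open>\<Sum> 1 / p\<close> as well, which is at most the logarithm of the product.
\<close>
lemma euler_product_intermediate:
  assumes "M \<ge> 1" "M \<le> ln (real Z + 1)"
  obtains z where "z \<le> Z" "M \<le> euler_product z" "euler_product z \<le> 2 * M"
proof -
  define z where "z = (LEAST z. M \<le> euler_product z)"
  have Z: "M \<le> euler_product Z" using assms ln_le_euler_product[of Z] by linarith
  have "M \<le> euler_product z" unfolding z_def using Z by (rule LeastI)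
  moreover have "z \<le> Z" unfolding z_def using Z by (rule Least_le)
  moreover have "euler_product z \<le> 2 * M"
  proof (cases z)
    case 0
    have "{p::nat. prime p \<and> p \<le> 0} = {}" by auto
    hence "euler_product 0 = 1" unfolding euler_product_def by (simp only: prod.empty)
    thus ?thesis using 0 assms by simp
  next
    case (Suc y)
    hence "\<not> M \<le> euler_product y" using not_less_Least[of y "\<lambda>z. M \<le> euler_product z"] by (simp add: z_def)
    thus ?thesis using euler_product_Suc_le[of y] Suc by simp
  qed
  ultimately show ?thesis using that by blast
qed

lemma sum_inverse_primes_le_ln_euler_product:
  "(\<Sum>p | prime p \<and> p \<le> z. 1 / real p) \<le> ln (euler_product z)"
proof -
  have "ln (euler_product z) = (\<Sum>p | prime p \<and> p \<le> z. ln (1 / (1 - 1 / real p)))"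
    unfolding euler_product_def by (intro ln_prod) (auto dest: prime_gt_1_nat)
  also have "\<dots> \<ge> (\<Sum>p | prime p \<and> p \<le> z. 1 / real p)"
  proof (intro sum_mono)
    fix p :: nat assume "p \<in> {p. prime p \<and> p \<le> z}"
    hence "p > 1" by (auto dest: prime_gt_1_nat)
    hence "ln (1 - 1 / real p) \<le> - (1 / real p)"
      using ln_le_minus_one[of "1 - 1 / real p"] by simp
    thus "1 / real p \<le> ln (1 / (1 - 1 / real p))"
      using \<open>p > 1\<close> by (simp add: ln_div)
  qed
  finally show ?thesis .
qed

text \<open>
  The product is largest for \<open>A = {2..card A + 1}\<close>, where it telescopes to \<open>card A + 1\<close>; hence
  adding a new maximum \<open>b\<close> costs at most the factor \<open>(card A + 2) / (card A + 1)\<close>. Applied to the prime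
  divisors of \<open>h\<close>, this bounds the loss from leaving them out of the sieve.
\<close>
lemma prod_inverse_one_minus_le:
  fixes A :: "nat set"
  assumes "finite A" "\<And>a. a \<in> A \<Longrightarrow> a \<ge> 2"
  shows "(\<Prod>a\<in>A. 1 / (1 - 1 / real a)) \<le> real (card A) + 1"
  using assms
proof (induction A rule: finite_linorder_max_induct)
  case (insert b A)
  have "A \<subseteq> {2..<b}" using insert by auto
  hence "card A \<le> card {2..<b}" by (intro card_mono) auto
  moreover have "b \<ge> 2" using insert by auto
  ultimately have b: "card A + 2 \<le> b" by auto
  have nb: "b \<notin> A" using insert by auto
  have "(\<Prod>a\<in>insert b A. 1 / (1 - 1 / real a)) = 1 / (1 - 1 / real b) * (\<Prod>a\<in>A. 1 / (1 - 1 / real a))"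
    using insert nb by simp
  also have "\<dots> \<le> 1 / (1 - 1 / real b) * (real (card A) + 1)"
    using insert b by (intro mult_left_mono) auto
  also have "\<dots> \<le> real (card A) + 2"
  proof -
    have "real b \<ge> real (card A) + 2" using b by linarith
    thus ?thesis by (simp add: field_simps)
  qed
  finally show ?case using insert nb by simp
qed simp

lemma card_prime_divisors_le:
  fixes h :: nat
  assumes "h > 0"
  shows "real (card {p. prime p \<and> p dvd h}) \<le> log 2 (real h)"
proof -
  have eq: "{p. prime p \<and> p dvd h} = prime_factors h"
    using assms by (auto simp: prime_factors_dvd)
  have "(2::nat) ^ card (prime_factors h) = (\<Prod>p\<in>prime_factors h. 2)" by simp
  also have "\<dots> \<le> (\<Prod>p\<in>prime_factors h. p ^ multiplicity p h)"
  proof (intro prod_mono conjI)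
    fix p assume p: "p \<in> prime_factors h"
    hence "multiplicity p h \<ge> 1" "p \<ge> 2"
      using assms by (auto simp: prime_ge_2_nat prime_factors_multiplicity)
    thus "2 \<le> p ^ multiplicity p h"
      using self_le_power[of p "multiplicity p h"] by linarith
  qed auto
  also have "\<dots> = h" using prod_prime_factors[of h] assms by simp
  finally have "(2::real) ^ card (prime_factors h) \<le> real h"
    by (metis of_nat_le_iff of_nat_numeral of_nat_power)
  thus ?thesis unfolding eq using assms by (simp add: le_log_iff powr_realpow)
qed

text \<open>
  The term \<open>(e * \<sigma>) ^ t / t!\<close> of the exponential series is at most \<open>exp (e * \<sigma>)\<close>, and \<open>e \<le> 3\<close>. This makes the
  truncation error of the sieve small as soon as \<open>t\<close> exceeds \<open>3 * \<sigma>\<close>.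
\<close>
lemma power_div_fact_le_exp:
  fixes \<sigma> :: real
  assumes "\<sigma> \<ge> 0"
  shows "\<sigma> ^ t / fact t \<le> exp (3 * \<sigma> - real t)"
proof -
  have "(exp 1 * \<sigma>) ^ t / fact t \<le> exp (exp 1 * \<sigma>)"
  proof -
    have "(\<Sum>n\<in>{t}. (exp 1 * \<sigma>) ^ n /\<^sub>R fact n) \<le> (\<Sum>n. (exp 1 * \<sigma>) ^ n /\<^sub>R fact n)"
      using assms by (intro sum_le_suminf summable_exp_generic) auto
    thus ?thesis by (simp add: exp_def divide_inverse mult.commute)
  qed
  also have "\<dots> \<le> exp (3 * \<sigma>)"
    using assms exp_le by (simp add: mult_right_mono)
  finally have "exp (real t) * (\<sigma> ^ t / fact t) \<le> exp (3 * \<sigma>)"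
    by (simp add: power_mult_distrib exp_of_nat_mult flip: exp_of_nat_mult)
  thus ?thesis by (simp add: exp_diff field_simps)
qed

section \<open>Pairs of primes with a given difference\<close>

text \<open>
  Sieve by the primes \<open>p \<le> z\<close> not dividing \<open>h\<close>, where \<open>z\<close> is chosen so that the Euler product up to \<open>z\<close>
  lies between \<open>M\<close> and \<open>2 * M\<close>. Modulo each of them \<open>m\<close> avoids the two classes of
  \<open>0\<close> and \<open>- h\<close>, unless \<open>m \<le> z\<close>. The main term is at most \<open>n * \<Prod> (1 - 1 / p)\<^sup>2\<close> over the sieving primes; over all
  primes up to \<open>z\<close> the product would be at most \<open>1 / M\<^sup>2\<close>, and the omitted divisors of \<open>h\<close> cost the
  factor \<open>(1 + log 2 h)\<^sup>2\<close>. The other terms are the small primes, the truncation error and the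
  rounding errors.
\<close>
lemma card_prime_pairs_le:
  fixes h n t :: nat and M :: real
  assumes "h > 0" "M \<ge> 1"
  shows "real (card {m \<in> {..n}. prime m \<and> prime (m + h)}) \<le>
    exp M + real n * ((1 + log 2 (real h))\<^sup>2 / M\<^sup>2) + real n * exp (6 * ln (2 * M) - real t) + (1 + 2 * exp M) ^ t"
proof -
  define Z where "Z = nat \<lfloor>exp M\<rfloor>"
  have Z: "real Z \<le> exp M" "exp M \<le> real Z + 1" unfolding Z_def using exp_gt_zero[of M] by linarith+
  have "M \<le> ln (real Z + 1)" using Z by (subst ln_ge_iff) auto
  then obtain z where z: "z \<le> Z" "M \<le> euler_product z" "euler_product z \<le> 2 * M"
    using euler_product_intermediate[OF assms(2)] by blast
  define W where "W = euler_product z"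
  define Q where "Q = {p. prime p \<and> p \<le> z \<and> \<not> p dvd h}"
  define D where "D = {p. prime p \<and> p dvd h}"
  \<comment> \<open>The residue of \<open>- h\<close> modulo \<open>p\<close>, written with truncated subtraction on the naturals.\<close>
  define \<Omega> where "\<Omega> = (\<lambda>p. {0, (p - h mod p) mod p})"
  define S where "S = sifted \<Omega> Q 0 1 n"
  have fin: "finite Q" "finite D" using assms(1) unfolding Q_def D_def by auto
  have Qprime: "prime p" "p > 1" "p \<le> z" "\<not> p dvd h" if "p \<in> Q" for p
    using that by (auto simp: Q_def prime_gt_Suc_0_nat)
  have shift: "m mod p = (p - h mod p) mod p \<longleftrightarrow> p dvd m + h" if "p > 0" for m p :: nat
  proof -
    have "h mod p < p" using that by simp
    hence "m mod p = (p - h mod p) mod p \<longleftrightarrow> (m + h) mod p = ((p - h mod p) + h) mod p"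
      by (metis (no_types, opaque_lifting) unique_euclidean_semiring_class.cong_def cong_add_rcancel_nat)
    also have "((p - h mod p) + h) mod p = ((p - h mod p) + h mod p) mod p" by (simp only: mod_add_right_eq)
    also have "\<dots> = 0" using \<open>h mod p < p\<close> by simp
    finally show ?thesis by (simp add: dvd_eq_mod_eq_0)
  qed
  have card\<Omega>: "card (\<Omega> p) = 2" if "p \<in> Q" for p
  proof -
    have "0 mod p \<noteq> (p - h mod p) mod p" using shift[of p 0] Qprime[OF that] by simp
    thus ?thesis by (simp add: \<Omega>_def)
  qed
  have sub: "{m \<in> {..n}. prime m \<and> prime (m + h)} \<subseteq> {1..Z} \<union> S"
  proof
    fix m assume m: "m \<in> {m \<in> {..n}. prime m \<and> prime (m + h)}"
    show "m \<in> {1..Z} \<union> S"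
    proof (cases "m \<le> Z")
      case True
      thus ?thesis using m prime_ge_1_nat by auto
    next
      case False
      have "m mod p \<notin> \<Omega> p" if "p \<in> Q" for p
      proof -
        have p: "prime p" "p > 0" "p \<noteq> m" "p \<noteq> m + h" using Qprime[OF that] False z by auto
        have "\<not> p dvd m" "\<not> p dvd m + h" using m p primes_dvd_imp_eq by blast+
        thus ?thesis unfolding \<Omega>_def insert_iff empty_iff shift[OF p(2)] by (simp add: dvd_eq_mod_eq_0)
      qed
      thus ?thesis using False m by (auto simp: S_def sifted_def)
    qed
  qed
  have "card {m \<in> {..n}. prime m \<and> prime (m + h)} \<le> card ({1..Z} \<union> S)"
    using sub by (intro card_mono) (auto simp: S_def)
  also have "\<dots> \<le> Z + card S" using card_Un_le[of "{1..Z}" S] by simp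
  finally have 1: "real (card {m \<in> {..n}. prime m \<and> prime (m + h)}) \<le> exp M + real (card S)"
    using Z by linarith
  define V where "V = (\<Prod>p\<in>Q. 1 - 2 / real p)"
  define \<sigma> where "\<sigma> = (\<Sum>p\<in>Q. 2 / real p)"
  have \<Omega>sub: "\<Omega> q \<subseteq> {..<q}" if "q \<in> Q" for q using Qprime[OF that] by (auto simp: \<Omega>_def)
  have "\<bar>real (card (sifted \<Omega> Q 0 1 n)) - real n / real 1 * (\<Prod>q\<in>Q. 1 - real (card (\<Omega> q)) / real q)\<bar>
     \<le> real n / real 1 * (\<Sum>q\<in>Q. real 2 / real q) ^ t / fact t + (1 + real 2 * real (card Q)) ^ t"
    using fin Qprime card\<Omega> \<Omega>sub
    by (intro sieve_fundamental_lemma) (auto simp: pairwise_def intro!: primes_coprime dest: prime_gt_0_nat)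
  also have "(\<Prod>q\<in>Q. 1 - real (card (\<Omega> q)) / real q) = V"
    unfolding V_def by (intro prod.cong) (auto simp: card\<Omega>)
  finally have 2: "real (card S) \<le> n * V + n * (\<sigma> ^ t / fact t) + (1 + 2 * real (card Q)) ^ t"
    by (simp add: S_def \<sigma>_def)
  have 3: "(1 + 2 * real (card Q)) ^ t \<le> (1 + 2 * exp M) ^ t"
  proof -
    have "Q \<subseteq> {1..Z}" using Qprime z by force
    hence "card Q \<le> card {1..Z}" by (intro card_mono) auto
    thus ?thesis using Z by (intro power_mono) auto
  qed
  have 4: "\<sigma> ^ t / fact t \<le> exp (6 * ln (2 * M) - real t)"
  proof -
    have \<sigma>0: "\<sigma> \<ge> 0" unfolding \<sigma>_def by (intro sum_nonneg) auto
    have "\<sigma> = 2 * (\<Sum>p\<in>Q. 1 / real p)" by (simp add: \<sigma>_def sum_distrib_left)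
    also have "(\<Sum>p\<in>Q. 1 / real p) \<le> (\<Sum>p | prime p \<and> p \<le> z. 1 / real p)"
      by (intro sum_mono2) (auto simp: Q_def)
    also have "\<dots> \<le> ln (euler_product z)" by (rule sum_inverse_primes_le_ln_euler_product)
    also have "\<dots> \<le> ln (2 * M)" using z assms by simp
    finally have "3 * \<sigma> - real t \<le> 6 * ln (2 * M) - real t" by simp
    thus ?thesis using power_div_fact_le_exp[OF \<sigma>0, of t] by (meson exp_le_cancel_iff order_trans)
  qed
  have 5: "V \<le> (1 + log 2 (real h))\<^sup>2 / M\<^sup>2"
  proof -
    define P where "P = (\<Prod>p\<in>Q. 1 / (1 - 1 / real p))"
    define E where "E = (\<Prod>p\<in>D. 1 / (1 - 1 / real p))"
    have "0 < 1 / (1 - 1 / real p)" if "p \<in> Q" for p using Qprime(2)[OF that] by simp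
    hence P0: "P > 0" unfolding P_def by (intro prod_pos)
    have D2: "p \<ge> 2" if "p \<in> D" for p using that by (auto simp: D_def prime_ge_2_nat)
    have "{p. prime p \<and> p \<le> z} = Q \<union> {p \<in> D. p \<le> z}" by (auto simp: Q_def D_def)
    hence "euler_product z = P * (\<Prod>p\<in>{p \<in> D. p \<le> z}. 1 / (1 - 1 / real p))"
      unfolding euler_product_def P_def using fin by (simp only:) (intro prod.union_disjoint, auto simp: Q_def D_def)
    also have "\<dots> \<le> P * (real (card {p \<in> D. p \<le> z}) + 1)"
      using P0 fin D2 by (intro mult_left_mono prod_inverse_one_minus_le) auto
    also have "\<dots> \<le> P * (1 + log 2 (real h))"
    proof (intro mult_left_mono)
      have "card {p \<in> D. p \<le> z} \<le> card D" using fin by (intro card_mono) auto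
      thus "real (card {p \<in> D. p \<le> z}) + 1 \<le> 1 + log 2 (real h)"
        using card_prime_divisors_le[OF assms(1)] unfolding D_def by simp
    qed (use P0 in simp)
    finally have MP: "M \<le> P * (1 + log 2 (real h))" using z by linarith
    have "V \<le> (\<Prod>p\<in>Q. (1 - 1 / real p)\<^sup>2)"
      unfolding V_def
    proof (intro prod_mono conjI)
      fix p assume p: "p \<in> Q"
      show "0 \<le> 1 - 2 / real p" using Qprime[OF p] by (simp add: field_simps)
      show "1 - 2 / real p \<le> (1 - 1 / real p)\<^sup>2" by (simp add: power2_eq_square algebra_simps)
    qed
    also have "\<dots> = 1 / P\<^sup>2"
      unfolding P_def by (simp add: prod_dividef prod_power_distrib power_divide)
    also have "\<dots> \<le> (1 + log 2 (real h))\<^sup>2 / M\<^sup>2"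
    proof -
      have "M\<^sup>2 \<le> (P * (1 + log 2 (real h)))\<^sup>2" using MP assms by (intro power_mono) auto
      hence "M\<^sup>2 / P\<^sup>2 \<le> (1 + log 2 (real h))\<^sup>2"
        using P0 by (subst pos_divide_le_eq) (simp_all only: power_mult_distrib mult.commute zero_less_power)
      hence "1 / P\<^sup>2 * M\<^sup>2 \<le> (1 + log 2 (real h))\<^sup>2" by simp
      thus ?thesis using assms(2) by (subst pos_le_divide_eq) simp_all
    qed
    finally show ?thesis .
  qed
  have "real n * V \<le> real n * ((1 + log 2 (real h))\<^sup>2 / M\<^sup>2)" using 5 by (intro mult_left_mono) auto
  moreover have "real n * (\<sigma> ^ t / fact t) \<le> real n * exp (6 * ln (2 * M) - real t)"
    using 4 by (intro mult_left_mono) auto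
  ultimately show ?thesis using 1 2 3 by linarith
qed

text \<open>
  Up to powers of \<open>ln (ln n)\<close> the sieve saves a factor \<open>M\<^sup>2\<close>. The choice
  \<open>M = (ln n) powr 0.98\<close> makes \<open>exp M\<close> and all rounding errors negligible and saves
  \<open>(ln n) powr 1.96\<close>, so that \<open>1.9\<close> leaves room for the logarithmic losses, uniformly in \<open>h\<close>.
\<close>
lemma card_prime_pairs_asymptotic:
  "\<forall>\<^sub>F n in sequentially. \<forall>h::nat. h > 0 \<and> real h \<le> (ln (real n))\<^sup>2 \<longrightarrow>
     real (card {m \<in> {..n}. prime m \<and> prime (m + h)}) \<le> real n / ln (real n) powr 1.9"
proof -
  \<comment> \<open>The previous bound in terms of \<open>L = ln n\<close>, with \<open>M = L powr 0.98\<close> and \<open>t\<close> just above \<open>8 * ln (2 * M)\<close>.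
     Then \<open>6 * ln (2 * M) - t \<le> - 2 * ln (2 * M)\<close>, so the truncation error is of the size of the
     main term.\<close>
  define F :: "real \<Rightarrow> real" where
    "F = (\<lambda>L. exp (L powr 0.98) + exp L * ((1 + 2 * ln L / ln 2)\<^sup>2 / (L powr 0.98)\<^sup>2)
        + exp L * exp (- 2 * ln (2 * L powr 0.98))
        + exp ((L powr 0.98 + 2) * (8 * ln (2 * L powr 0.98) + 1)))"
  have "\<forall>\<^sub>F L in at_top. F L \<le> exp L / L powr 1.9"
    unfolding F_def by real_asymp
  moreover have "\<forall>\<^sub>F L::real in at_top. L \<ge> 1" by (rule eventually_ge_at_top)
  ultimately have "\<forall>\<^sub>F L in at_top. F L \<le> exp L / L powr 1.9 \<and> L \<ge> 1" by eventually_elim auto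
  moreover have "filterlim (\<lambda>n. ln (real n)) at_top sequentially" by real_asymp
  ultimately have "\<forall>\<^sub>F n in sequentially. F (ln (real n)) \<le> exp (ln (real n)) / ln (real n) powr 1.9 \<and> ln (real n) \<ge> 1"
    by (rule eventually_compose_filterlim)
  moreover have "\<forall>\<^sub>F n::nat in sequentially. n > 0" by (rule eventually_gt_at_top)
  ultimately show ?thesis
  proof eventually_elim
    case (elim n)
    define L where "L = ln (real n)"
    define M where "M = L powr 0.98"
    define t where "t = nat \<lceil>8 * ln (2 * M)\<rceil>"
    have L: "L \<ge> 1" "exp L = real n" "F L \<le> real n / L powr 1.9" using elim by (auto simp: L_def)
    have M: "M \<ge> 1" using L by (simp add: M_def ge_one_powr_ge_zero)
    have "ln (2 * M) \<ge> 0" using M by simp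
    hence t: "8 * ln (2 * M) \<le> real t" "real t \<le> 8 * ln (2 * M) + 1" unfolding t_def by linarith+
    show ?case
    proof (intro allI impI)
      fix h :: nat assume h: "h > 0 \<and> real h \<le> (ln (real n))\<^sup>2"
      have "log 2 (real h) \<le> log 2 (L\<^sup>2)" using h L(1) by (intro log_mono) (auto simp: L_def)
      also have "\<dots> = 2 * ln L / ln 2" using L by (simp add: log_def ln_realpow)
      finally have "(1 + log 2 (real h))\<^sup>2 \<le> (1 + 2 * ln L / ln 2)\<^sup>2"
        using h by (intro power_mono) (auto intro!: add_nonneg_nonneg)
      hence 1: "real n * ((1 + log 2 (real h))\<^sup>2 / M\<^sup>2) \<le> exp L * ((1 + 2 * ln L / ln 2)\<^sup>2 / M\<^sup>2)"
        unfolding L(2) by (intro mult_left_mono divide_right_mono) auto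
      have 2: "real n * exp (6 * ln (2 * M) - real t) \<le> exp L * exp (- 2 * ln (2 * M))"
        unfolding L(2) using t by (intro mult_left_mono) auto
      have "1 + 2 * exp M \<le> exp M * exp 2"
      proof -
        have "exp (2::real) \<ge> 3" using exp_ge_add_one_self[of 2] by simp
        hence "exp M * 3 \<le> exp M * exp 2" by (intro mult_left_mono) auto
        moreover have "exp M \<ge> 1" using M by simp
        ultimately show ?thesis by linarith
      qed
      hence "(1 + 2 * exp M) ^ t \<le> exp (M + 2) ^ t" by (intro power_mono) (auto simp: exp_add add_nonneg_nonneg)
      also have "\<dots> = exp ((M + 2) * real t)" by (simp add: mult.commute flip: exp_of_nat_mult)
      also have "\<dots> \<le> exp ((M + 2) * (8 * ln (2 * M) + 1))" using t M by simp
      finally have 3: "(1 + 2 * exp M) ^ t \<le> exp ((M + 2) * (8 * ln (2 * M) + 1))" .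
      have "real (card {m \<in> {..n}. prime m \<and> prime (m + h)}) \<le> F L"
        using card_prime_pairs_le[of h M n t] h M 1 2 3 unfolding F_def M_def[symmetric] by linarith
      thus "real (card {m \<in> {..n}. prime m \<and> prime (m + h)}) \<le> real n / ln (real n) powr 1.9"
        using L by (simp add: L_def)
    qed
  qed
qed

section \<open>Blocks of consecutive terms and their differences\<close>

text \<open>
  Cut the first \<open>b * k\<close> values of \<open>p\<close> into \<open>b\<close> blocks and pick in each block two values whose
  difference lies in \<open>H\<close>. These gaps are disjoint subintervals of \<open>[0, n]\<close>, so at most \<open>n / T\<close> of
  them exceed \<open>T\<close>. Every other block contributes a pair with difference \<open>h \<le> T\<close>, and
  different blocks contribute different pairs.
\<close>
lemma card_blocks_with_difference_le:
  fixes p :: "nat \<Rightarrow> nat" and H :: "nat set"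
  assumes "strict_mono p" "T > 0"
    and small: "\<And>i. i < b * k \<Longrightarrow> p i \<le> n"
    and bad: "\<And>j. j < b \<Longrightarrow> \<exists>i i'. j * k \<le> i \<and> i < i' \<and> i' < Suc j * k \<and> p i' - p i \<in> H"
  shows "real b \<le> real n / real T +
     (\<Sum>h\<in>H \<inter> {1..T}. real (card {m \<in> {..n}. m \<in> range p \<and> m + h \<in> range p}))"
proof -
  obtain f f' where f: "\<And>j. j < b \<Longrightarrow> j * k \<le> f j \<and> f j < f' j \<and> f' j < Suc j * k \<and> p (f' j) - p (f j) \<in> H"
    using bad by metis
  have less: "p i < p j" if "i < j" for i j using assms(1) that by (simp add: strict_mono_def)
  have le: "p i \<le> p j" if "i \<le> j" for i j using less[of i j] that by (cases "i = j") auto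
  define gap where "gap = (\<lambda>j. p (f' j) - p (f j))"
  define wide where "wide = {j \<in> {..<b}. gap j > T}"
  define narrow where "narrow = {j \<in> {..<b}. gap j \<le> T}"
  define pairs where "pairs = (SIGMA h:H \<inter> {1..T}. {m \<in> {..n}. m \<in> range p \<and> m + h \<in> range p})"
  have idx: "Suc j * k \<le> b * k" if "j < b" for j using that by (intro mult_right_mono) auto
  have telescope: "(\<Sum>j<c. gap j) \<le> n" if "c \<le> b" for c
  proof -
    define g where "g = (\<lambda>j. if j = 0 then 0 else p (j * k - 1))"
    have "gap j + g j \<le> g (Suc j)" if "j < c" for j
    proof -
      have fj: "j * k \<le> f j" "f j < f' j" "f' j < Suc j * k" using f[of j] that \<open>c \<le> b\<close> by auto
      have "p (f' j) \<le> g (Suc j)" unfolding g_def using fj by (auto intro!: le)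
      moreover have "g j \<le> p (f j)" unfolding g_def using fj by (auto intro!: le)
      moreover have "p (f j) \<le> p (f' j)" using fj by (intro le) auto
      ultimately show ?thesis unfolding gap_def by linarith
    qed
    hence "(\<Sum>j<d. gap j) \<le> g d" if "d \<le> c" for d
      using that
    proof (induction d)
      case (Suc d)
      hence "(\<Sum>j<d. gap j) \<le> g d" "gap d + g d \<le> g (Suc d)" by auto
      thus ?case by simp
    qed simp
    moreover have "g c \<le> n"
    proof (cases "c = 0")
      case False
      then obtain d where d: "c = Suc d" by (cases c) auto
      have "k > 0" using f[of d] that d by (cases k) auto
      hence "c * k - 1 < b * k" using idx[of d] that d by auto
      thus ?thesis using False small unfolding g_def by simp
    qed (simp add: g_def)
    ultimately show ?thesis by fastforce
  qed
  have "card wide * T = (\<Sum>j\<in>wide. T)" by simp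
  also have "\<dots> \<le> (\<Sum>j\<in>wide. gap j)" by (intro sum_mono) (auto simp: wide_def)
  also have "\<dots> \<le> (\<Sum>j<b. gap j)" by (intro sum_mono2) (auto simp: wide_def)
  also have "\<dots> \<le> n" by (rule telescope) simp
  finally have "real (card wide) * real T \<le> real n" by (metis of_nat_le_iff of_nat_mult)
  hence 1: "real (card wide) \<le> real n / real T" using \<open>T > 0\<close> by (simp add: field_simps)
  have fin: "finite pairs" unfolding pairs_def by auto
  have "inj_on (\<lambda>j. (gap j, p (f j))) narrow"
  proof (rule inj_onI)
    fix i j assume ij: "i \<in> narrow" "j \<in> narrow" "(gap i, p (f i)) = (gap j, p (f j))"
    have eq: "f i = f j" using ij less[of "f i" "f j"] less[of "f j" "f i"]
      by (cases "f i" "f j" rule: linorder_cases) auto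
    have "f i < Suc i * k" "i * k \<le> f i" "f j < Suc j * k" "j * k \<le> f j"
      using f[of i] f[of j] ij by (auto simp: narrow_def)
    hence "i * k < Suc j * k" "j * k < Suc i * k" using eq by linarith+
    thus "i = j" using mult_less_cancel2 by (metis less_Suc_eq_le order_antisym)
  qed
  moreover have "(\<lambda>j. (gap j, p (f j))) ` narrow \<subseteq> pairs"
  proof safe
    fix j assume j: "j \<in> narrow"
    hence fj: "j * k \<le> f j" "f j < f' j" "f' j < Suc j * k" "gap j \<in> H" "j < b" "gap j \<le> T"
      using f[of j] by (auto simp: narrow_def gap_def)
    have lt: "p (f j) < p (f' j)" using fj less by blast
    hence "p (f j) + gap j = p (f' j)" "gap j \<ge> 1" by (auto simp: gap_def)
    moreover have "p (f j) \<le> n" using idx[of j] fj by (intro small) linarith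
    ultimately show "(gap j, p (f j)) \<in> pairs" using fj unfolding pairs_def by auto
  qed
  ultimately have "card narrow \<le> card pairs"
    by (meson card_inj_on_le fin)
  also have "card pairs = (\<Sum>h\<in>H \<inter> {1..T}. card {m \<in> {..n}. m \<in> range p \<and> m + h \<in> range p})"
    unfolding pairs_def by (subst card_SigmaI) auto
  finally have "real (card narrow) \<le> real (\<Sum>h\<in>H \<inter> {1..T}. card {m \<in> {..n}. m \<in> range p \<and> m + h \<in> range p})"
    by (simp only: of_nat_le_iff)
  hence 2: "real (card narrow) \<le> (\<Sum>h\<in>H \<inter> {1..T}. real (card {m \<in> {..n}. m \<in> range p \<and> m + h \<in> range p}))"
    by (simp only: of_nat_sum)
  have "{..<b} = wide \<union> narrow" by (auto simp: wide_def narrow_def)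
  hence "card {..<b} = card (wide \<union> narrow)" by (rule arg_cong)
  also have "\<dots> = card wide + card narrow"
    by (rule card_Un_disjoint) (auto simp: wide_def narrow_def)
  finally have "b = card wide + card narrow" by simp
  thus ?thesis using 1 2 by simp
qed

lemma enumerate_le_if_less_card:
  fixes S :: "nat set"
  assumes "infinite S" "i < card {s \<in> S. s \<le> n}"
  shows "enumerate S i \<le> n"
proof (rule ccontr)
  assume "\<not> enumerate S i \<le> n"
  have "{s \<in> S. s \<le> n} \<subseteq> enumerate S ` {..<i}"
  proof
    fix s assume s: "s \<in> {s \<in> S. s \<le> n}"
    then obtain j where j: "enumerate S j = s" using enumerate_Ex[OF assms(1)] by blast
    hence "j < i" using s \<open>\<not> enumerate S i \<le> n\<close> enumerate_mono_le_iff[OF assms(1), of i j] by auto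
    thus "s \<in> enumerate S ` {..<i}" using j by blast
  qed
  hence "card {s \<in> S. s \<le> n} \<le> card (enumerate S ` {..<i})" by (intro card_mono) auto
  also have "\<dots> \<le> card {..<i}" by (intro card_image_le) auto
  finally show False using assms(2) by simp
qed

section \<open>Square differences among consecutive primes\<close>

lemma card_squares_le:
  "real (card ({h. \<exists>u. h = u\<^sup>2} \<inter> {1..T})) \<le> sqrt (real T)"
proof -
  have "{h. \<exists>u. h = u\<^sup>2} \<inter> {1..T} \<subseteq> (\<lambda>u. u\<^sup>2) ` {1..nat \<lfloor>sqrt (real T)\<rfloor>}"
  proof
    fix h assume "h \<in> {h. \<exists>u. h = u\<^sup>2} \<inter> {1..T}"
    then obtain u where u: "h = u\<^sup>2" "1 \<le> u\<^sup>2" "u\<^sup>2 \<le> T" by auto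
    have "(real u)\<^sup>2 \<le> real T" using u(3) by (metis of_nat_le_iff of_nat_power)
    hence "real u \<le> sqrt (real T)" by (rule real_le_rsqrt)
    hence "u \<le> nat \<lfloor>sqrt (real T)\<rfloor>" by linarith
    moreover have "u \<ge> 1" using u(2) by (cases u) auto
    ultimately show "h \<in> (\<lambda>u. u\<^sup>2) ` {1..nat \<lfloor>sqrt (real T)\<rfloor>}" using u(1) by auto
  qed
  hence "card ({h. \<exists>u. h = u\<^sup>2} \<inter> {1..T}) \<le> card ((\<lambda>u. u\<^sup>2) ` {1..nat \<lfloor>sqrt (real T)\<rfloor>})"
    by (intro card_mono) auto
  also have "\<dots> \<le> card {1..nat \<lfloor>sqrt (real T)\<rfloor>}" by (intro card_image_le) auto
  finally have "card ({h. \<exists>u. h = u\<^sup>2} \<inter> {1..T}) \<le> nat \<lfloor>sqrt (real T)\<rfloor>" by simp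
  moreover have "sqrt (real T) \<ge> 0" by simp
  ultimately show ?thesis by linarith
qed

lemma square_difference_cases:
  fixes p q :: nat
  assumes "is_square (int p - int q)" "p \<noteq> q"
  shows "q < p" "\<exists>u. p - q = u\<^sup>2"
proof -
  obtain y where y: "int p - int q = y\<^sup>2" using assms(1) by (auto elim: is_nth_powerE)
  have "int q \<le> int p" using y zero_le_power2[of y] by linarith
  thus less: "q < p" using assms(2) by simp
  have "int (p - q) = int ((nat \<bar>y\<bar>)\<^sup>2)" using y less by (simp add: of_nat_diff)
  thus "\<exists>u. p - q = u\<^sup>2" by (metis of_nat_eq_iff)
qed

text \<open>
  Suppose that every run of \<open>k\<close> consecutive primes up to \<open>n\<close> contains a square difference, and cut the
  \<open>N\<close> primes up to \<open>n\<close> into \<open>N div k\<close> such runs. With \<open>L = ln n\<close> and \<open>T\<close> about \<open>8 * k * L\<close>, at most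
  \<open>n / (8 * k * L)\<close> of the gaps exceed \<open>T\<close>, and the \<open>sqrt T\<close> squares up to \<open>T\<close> account for at
  most \<open>sqrt T * n / L powr 1.9\<close> runs. But \<open>N \<ge> n / (2 * L)\<close>, so there are at least about \<open>n / (2 * k * L)\<close>
  runs; for \<open>k \<le> L powr (1/4)\<close> this is more.
\<close>
lemma consecutive_primes_without_square_differences:
  "\<forall>\<^sub>F n in sequentially. \<forall>k::nat. k > 0 \<and> real k \<le> ln (real n) powr (1/4) \<longrightarrow>
     (\<exists>S. consecutive_primes k S \<and> S \<subseteq> {..n} \<and>
        (\<forall>p\<in>S. \<forall>q\<in>S. p \<noteq> q \<longrightarrow> \<not> is_square (int p - int q)))"
proof -
  have "\<forall>\<^sub>F n in sequentially. 9 * ln (real n) powr 1.25 \<le> (ln (real n))\<^sup>2"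
    by real_asymp
  moreover have "\<forall>\<^sub>F n in sequentially.
      real n / (8 * ln (real n)) + ln (real n) powr 0.25 * (3 * ln (real n) powr 0.625 * (real n / ln (real n) powr 1.9))
      < real n / (2 * ln (real n)) - ln (real n) powr 0.25"
    by real_asymp
  moreover have "\<forall>\<^sub>F n in sequentially. ln (real n) \<ge> 1" by real_asymp
  moreover have "\<forall>\<^sub>F n::nat in sequentially. n \<ge> 4" by (rule eventually_ge_at_top)
  ultimately show ?thesis using card_prime_pairs_asymptotic
  proof eventually_elim
    case (elim n)
    define L where "L = ln (real n)"
    define p where "p = enumerate {p::nat. prime p}"
    define N where "N = card {p. prime p \<and> p \<le> n}"
    define H :: "nat set" where "H = {h. \<exists>u. h = u\<^sup>2}"
    have L: "L \<ge> 1" using elim by (simp add: L_def)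
    have inf: "infinite {p::nat. prime p}" by (rule primes_infinite)
    have p_le: "p i \<le> n" if "i < N" for i
      using enumerate_le_if_less_card[OF inf, of i n] that by (simp add: p_def N_def)
    have mono: "strict_mono p" unfolding p_def by (rule strict_mono_enumerate[OF inf])
    have range: "m \<in> range p \<longleftrightarrow> prime m" for m
      unfolding p_def using range_enumerate[OF inf] by simp
    show ?case
    proof (intro allI impI)
      fix k :: nat assume k: "k > 0 \<and> real k \<le> ln (real n) powr (1/4)"
      show "\<exists>S. consecutive_primes k S \<and> S \<subseteq> {..n} \<and>
        (\<forall>p\<in>S. \<forall>q\<in>S. p \<noteq> q \<longrightarrow> \<not> is_square (int p - int q))"
      proof (rule ccontr)
        assume contra: "\<not> ?thesis"
        define b where "b = N div k"
        \<comment> \<open>By Chebyshev's bound the mean length of a block is at most about \<open>2 * k * L\<close>; four times that leaves room.\<close>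
        define T where "T = nat \<lceil>8 * real k * L\<rceil>"
        have kL: "real k \<le> L powr 0.25" using k by (simp add: L_def)
        have k1: "real k \<ge> 1" using k by simp
        have pos: "8 * real k * L > 0" using k L by simp
        have T: "8 * real k * L \<le> real T" "real T \<le> 8 * real k * L + 1" "T > 0"
          unfolding T_def using pos by linarith+
        have "real k * L \<ge> 1 * 1" using k1 L by (intro mult_mono) auto
        hence "real T \<le> 9 * (real k * L)" using T by linarith
        also have "\<dots> \<le> 9 * (L powr 0.25 * L)" using kL L by (intro mult_left_mono mult_right_mono) auto
        also have "L powr 0.25 * L = L powr 1.25" using L powr_add[of L "0.25" 1] by simp
        finally have T_le: "real T \<le> 9 * L powr 1.25" .
        have bad: "\<exists>i i'. j * k \<le> i \<and> i < i' \<and> i' < Suc j * k \<and> p i' - p i \<in> H" if j: "j < b" for j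
        proof -
          define S where "S = p ` {j * k..<j * k + k}"
          have "Suc j * k \<le> b * k" using j by (intro mult_right_mono) auto
          also have "b * k \<le> N" unfolding b_def by simp
          finally have "S \<subseteq> {..n}" unfolding S_def using p_le by auto
          moreover have "consecutive_primes k S" unfolding consecutive_primes_def S_def p_def by blast
          ultimately obtain q r where qr: "q \<in> S" "r \<in> S" "q \<noteq> r" "is_square (int q - int r)"
            using contra by blast
          obtain i' i where i: "q = p i'" "r = p i" "i' \<in> {j * k..<j * k + k}" "i \<in> {j * k..<j * k + k}"
            using qr(1,2) unfolding S_def by blast
          have "p i < p i'" "p i' - p i \<in> H"
            using square_difference_cases[OF qr(4,3)] i unfolding H_def by auto
          moreover from this have "i < i'" using mono by (simp add: strict_mono_less)
          ultimately show ?thesis using i by (intro exI[of _ i] exI[of _ i']) auto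
        qed
        have "real b \<le> real n / real T +
            (\<Sum>h\<in>H \<inter> {1..T}. real (card {m \<in> {..n}. m \<in> range p \<and> m + h \<in> range p}))"
        proof (rule card_blocks_with_difference_le[OF mono T(3) _ bad])
          fix i assume "i < b * k"
          also have "b * k \<le> N" unfolding b_def by simp
          finally show "p i \<le> n" by (rule p_le)
        qed
        also have "(\<Sum>h\<in>H \<inter> {1..T}. real (card {m \<in> {..n}. m \<in> range p \<and> m + h \<in> range p}))
            \<le> (\<Sum>h\<in>H \<inter> {1..T}. real n / L powr 1.9)"
        proof (intro sum_mono)
          fix h assume h: "h \<in> H \<inter> {1..T}"
          hence "real h \<le> real T" by simp
          also have "\<dots> \<le> L\<^sup>2" using T_le elim by (simp add: L_def)
          finally show "real (card {m \<in> {..n}. m \<in> range p \<and> m + h \<in> range p}) \<le> real n / L powr 1.9"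
            using elim h unfolding range L_def by simp
        qed
        also have "\<dots> = real (card (H \<inter> {1..T})) * (real n / L powr 1.9)" by simp
        also have "\<dots> \<le> 3 * L powr 0.625 * (real n / L powr 1.9)"
        proof (intro mult_right_mono)
          have "real (card (H \<inter> {1..T})) \<le> sqrt (real T)" unfolding H_def by (rule card_squares_le)
          also have "\<dots> \<le> sqrt ((3 * L powr 0.625)\<^sup>2)"
          proof (intro real_sqrt_le_mono)
            have "(L powr 0.625)\<^sup>2 = L powr 1.25" using L by (simp add: power2_eq_square flip: powr_add)
            thus "real T \<le> (3 * L powr 0.625)\<^sup>2" using T_le by (simp add: power_mult_distrib)
          qed
          also have "\<dots> = 3 * L powr 0.625" by (subst real_sqrt_abs) simp
          finally show "real (card (H \<inter> {1..T})) \<le> 3 * L powr 0.625" .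
        qed simp
        finally have "real b \<le> real n / real T + 3 * L powr 0.625 * (real n / L powr 1.9)" by simp
        hence "real k * real b \<le> real k * (real n / real T) + real k * (3 * L powr 0.625 * (real n / L powr 1.9))"
          by (subst distrib_left [symmetric]) (intro mult_left_mono, auto)
        also have "real k * (real n / real T) \<le> real k * (real n / (8 * real k * L))"
        proof (rule mult_left_mono)
          show "real n / real T \<le> real n / (8 * real k * L)"
          proof (rule divide_left_mono[OF T(1)])
            show "0 < real T * (8 * real k * L)" by (rule mult_pos_pos[OF _ pos]) (use T(3) in simp)
          qed simp
        qed simp
        also have "\<dots> = real n / (8 * L)" using k1 by simp
        also have "real k * (3 * L powr 0.625 * (real n / L powr 1.9)) \<le>
            L powr 0.25 * (3 * L powr 0.625 * (real n / L powr 1.9))"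
          using kL by (intro mult_right_mono) auto
        finally have upper: "real k * real b < real n / (2 * L) - L powr 0.25"
          using elim(2) unfolding L_def[symmetric] by linarith
        have "N = k * b + N mod k" "N mod k < k" using k unfolding b_def by simp_all
        hence "N \<le> k * b + k" by linarith
        hence "real N \<le> real (k * b + k)" by (simp only: of_nat_le_iff)
        hence "real N \<le> real k * real b + real k" by simp
        moreover have "real n / (2 * L) \<le> real N"
          using elim prime_count_lower_bound[of n] unfolding L_def N_def by simp
        ultimately show False using upper kL by linarith
      qed
    qed
  qed
qed

text \<open>
  It remains to pass from real \<open>x\<close> to \<open>n = nat \<lfloor>x\<rfloor>\<close>. The constant \<open>0.24\<close> leaves ample room for this, because
  \<open>ln x \<le> 2 * ln n\<close>. If \<open>k = 0\<close>, the empty set is a run of \<open>k\<close> consecutive primes.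
\<close>
theorem theorem6:
  shows "\<exists>x0::real. x0 > 0 \<and> (\<forall>x::real. x \<ge> x0 \<longrightarrow>
    (\<exists>S::nat set.
       consecutive_primes (nat \<lfloor>0.24 * (ln x) powr (1/4)\<rfloor>) S \<and>
       S \<subseteq> {m. 1 \<le> m \<and> real m \<le> x} \<and>
       (\<forall>p\<in>S. \<forall>q\<in>S. p \<noteq> q \<longrightarrow> \<not> is_square (int p - int q))))"
proof -
  obtain n0 where n0: "\<And>n k. n \<ge> n0 \<Longrightarrow> k > 0 \<Longrightarrow> real k \<le> ln (real n) powr (1/4) \<Longrightarrow>
     (\<exists>S. consecutive_primes k S \<and> S \<subseteq> {..n} \<and>
        (\<forall>p\<in>S. \<forall>q\<in>S. p \<noteq> q \<longrightarrow> \<not> is_square (int p - int q)))"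
    using consecutive_primes_without_square_differences unfolding eventually_sequentially by blast
  show ?thesis
  proof (intro exI[of _ "real n0 + 3"] conjI allI impI)
    fix x :: real assume x: "x \<ge> real n0 + 3"
    define k where "k = nat \<lfloor>0.24 * (ln x) powr (1/4)\<rfloor>"
    define n where "n = nat \<lfloor>x\<rfloor>"
    have n: "n \<ge> n0" "n \<ge> 2" "real n \<le> x" "x \<le> real n + 1" using x unfolding n_def by linarith+
    have "\<exists>S. consecutive_primes k S \<and> S \<subseteq> {..n} \<and>
        (\<forall>p\<in>S. \<forall>q\<in>S. p \<noteq> q \<longrightarrow> \<not> is_square (int p - int q))"
    proof (cases "k = 0")
      case True
      thus ?thesis by (intro exI[of _ "{}"]) (auto simp: consecutive_primes_def)
    next
      case False
      have ln0: "ln x > 0" "ln (real n) \<ge> 0" using x n by auto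
      have "x \<le> (real n)\<^sup>2"
      proof -
        have "real n * 2 \<le> real n * real n" using n by (intro mult_left_mono) auto
        hence "x \<le> real n * real n" using n by linarith
        thus ?thesis by (simp add: power2_eq_square)
      qed
      hence "ln x \<le> ln ((real n)\<^sup>2)" using x n by (subst ln_le_cancel_iff) auto
      hence "ln x \<le> 2 * ln (real n)" using n by (simp add: ln_realpow)
      hence "ln x powr (1/4) \<le> (2 * ln (real n)) powr (1/4)" using ln0 by (intro powr_mono2) auto
      also have "\<dots> = 2 powr (1/4) * ln (real n) powr (1/4)" using ln0 by (simp add: powr_mult)
      also have "\<dots> \<le> 2 powr 1 * ln (real n) powr (1/4)" by (intro mult_right_mono powr_mono) auto
      finally have "0.24 * ln x powr (1/4) \<le> 0.48 * ln (real n) powr (1/4)" by simp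
      also have "\<dots> \<le> 1 * ln (real n) powr (1/4)" by (intro mult_right_mono) auto
      finally have "0.24 * ln x powr (1/4) \<le> ln (real n) powr (1/4)" by simp
      moreover have "real k \<le> 0.24 * ln x powr (1/4)" unfolding k_def by (rule of_nat_floor) simp
      ultimately have "real k \<le> ln (real n) powr (1/4)" by (rule order.trans[rotated])
      thus ?thesis using n0[of n k] n False by blast
    qed
    then obtain S where S: "consecutive_primes k S" "S \<subseteq> {..n}"
        "\<forall>p\<in>S. \<forall>q\<in>S. p \<noteq> q \<longrightarrow> \<not> is_square (int p - int q)" by blast
    have "prime p" if "p \<in> S" for p
      using S(1) that enumerate_in_set[OF primes_infinite] unfolding consecutive_primes_def by auto
    moreover have "real p \<le> x" if "p \<in> S" for p
    proof -
      have "p \<le> n" using S(2) that by auto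
      thus ?thesis using n(3) by linarith
    qed
    ultimately have "S \<subseteq> {m. 1 \<le> m \<and> real m \<le> x}"
      using prime_ge_1_nat by auto
    thus "\<exists>S::nat set.
       consecutive_primes (nat \<lfloor>0.24 * (ln x) powr (1/4)\<rfloor>) S \<and>
       S \<subseteq> {m. 1 \<le> m \<and> real m \<le> x} \<and>
       (\<forall>p\<in>S. \<forall>q\<in>S. p \<noteq> q \<longrightarrow> \<not> is_square (int p - int q))"
      using S unfolding k_def by blast
  qed simp
qed

end
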